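(* Let $q>1$ be a constant and assume the following. (i) There exists a diagonal matrix $\Gamma_n=\mathrm{diag}(\gamma_n^{(1)},\dots,\gamma_n^{(p)})$ with $\gamma_n^{(k)}>0$ and $\gamma_{n*}:=\max_{1\le k\le p}\gamma_n^{(k)}\downarrow0$ as $n\to\infty$ such that, as $n\to\infty$, $\Gamma_n^{-1}(\widehat\theta_n-\theta_0)\xrightarrow{d}Z$ and $\gamma_{n*}^{-1}(\widehat\theta_n-\theta_0)\xrightarrow{d}Z^*$ for $p$-dimensional random variables $Z$ and $Z^*$. (ii) There exists an $\mathcal X^p$-valued random element $Y^\theta$ such that $Y^\theta\in L^q$ and $$\|X^{\theta+u}-X^\theta-u^\top Y^\theta\|_{L^q}=o(|u|),\quad |u|\to0,$$ uniformly in $\theta\in\Theta$. (iii) There exists an $\mathbb{R}^p$-valued random variable $G_{\theta_0}\in L^1$ such that for each $u\in\mathbb{R}^p$ with $\theta_0+u\in\Theta$, $$\left|\mathbb{E}\left[h(X^{\theta_0+u},\theta_0)-h(X^{\theta_0},\theta_0)-u^\top G_{\theta_0}\right]\right|\lesssim\|X^{\theta_0+u}-X^{\theta_0}-u^\top Y^{\theta_0}\|_{L^q}+r_u,$$ where $r_u=o(|u|)$ as $|u|\to0$. Then, with $C_{\theta_0}=\mathbb{E}[G_{\theta_0}]$, $$\gamma_{n*}^{-1}\,\mathbb{E}\left[h(X^{\theta},\theta_0)-h(X^{\theta_0},\theta_0)\right]\Big|_{\theta=\widehat\theta_n}=C_{\theta_0}^\top\gamma_{n*}^{-1}(\widehat\theta_n-\theta_0)+o_p(1),\qquad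 n\to\infty.$$
   Context: $(\Omega,\mathcal F,\mathbb P)$ is a probability space, $\mathcal X$ is a metric space with norm $\|\cdot\|$ (a normed space), and $\Theta\subset\mathbb{R}^p$ is a parameter set with true value $\theta_0\in\Theta$. For each $\theta\in\Theta$, $X^\theta$ is an $\mathcal X$-valued random element. $h:\mathcal X\times\Theta\to\mathbb{R}$, and $H(\theta)=\mathbb{E}[h(X^\theta,\theta)]$ is the expected functional of interest. $\widehat\theta_n$ is an estimator of $\theta_0$ (a $\Theta$-valued random variable) computed from data indexed by $n\in\mathbb{N}$. $\mathbb{E}[\cdots]|_{\theta=\widehat\theta_n}$ means that the expectation is first computed for deterministic $\theta$ and then evaluated at $\theta=\widehat\theta_n$. For a random element $X$, $\|X\|_{L^q}=(\mathbb{E}\|X\|^q)^{1/q}$, and $X\in L^q$ means $\|X\|_{L^q}<\infty$. For $u\in\mathbb{R}^p$ and $Y=(Y_1,\dots,Y_p)\in\mathcal X^p$, $u^\top Y=\sum_i u_iY_i$. $A\lesssim B$ means that there is a universal constant $c>0$ (here: not depending on $u$) such that $A\le cB$. $\xrightarrow{d}$ is convergence in distribution, and $o_p(1)$ denotes convergence to $0$ in probability. *)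

theory Defs
  imports "HOL-Probability.Probability" "HOL-Library.Landau_Symbols"
begin

(* The value is an extended nonnegative real, so that the norm of a W outside L^q is \<infinity>
   (a Bochner integral would silently give 0). The case distinction only extends
   x powr (1/q) by \<infinity> powr (1/q) = \<infinity>. *)
definition Lq_norm :: "'b measure \<Rightarrow> real \<Rightarrow> ('b \<Rightarrow> 'x::real_normed_vector) \<Rightarrow> ennreal" where
  "Lq_norm M q W =
     (let I = (\<integral>\<^sup>+ \<omega>. ennreal (norm (W \<omega>) powr q) \<partial>M)
      in if I = \<infinity> then \<infinity> else ennreal (enn2real I powr (1 / q)))"

definition in_Lq :: "'b measure \<Rightarrow> real \<Rightarrow> ('b \<Rightarrow> 'x::real_normed_vector) \<Rightarrow> bool" where
  "in_Lq M q W \<longleftrightarrow> W \<in> borel_measurable M \<and> Lq_norm M q W < \<infinity>"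

(* The linear combination of u in R^p and a p-tuple of vectors of a normed space. *)
definition lincomb :: "real ^ 'p \<Rightarrow> 'x::real_normed_vector ^ 'p \<Rightarrow> 'x" where
  "lincomb u Y = (\<Sum>i\<in>UNIV. (u $ i) *\<^sub>R (Y $ i))"

definition diag_matrix :: "real ^ 'p \<Rightarrow> real ^ 'p ^ 'p" where
  "diag_matrix d = (\<chi> i j. if i = j then d $ i else 0)"

definition max_entry :: "real ^ 'p \<Rightarrow> real" where
  "max_entry d = Max (range (\<lambda>k. d $ k))"

(* Convergence in distribution, tested against bounded continuous functions. The limit Z may
   live on a probability space N of its own. *)
definition converges_in_distr ::
  "'b measure \<Rightarrow> (nat \<Rightarrow> 'b \<Rightarrow> 's::metric_space) \<Rightarrow> 'c measure \<Rightarrow> ('c \<Rightarrow> 's) \<Rightarrow> bool" where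
  "converges_in_distr M W N Z \<longleftrightarrow>
     (\<forall>n. W n \<in> borel_measurable M) \<and> Z \<in> borel_measurable N \<and>
     (\<forall>f :: 's \<Rightarrow> real. continuous_on UNIV f \<longrightarrow> bounded (range f) \<longrightarrow>
        (\<lambda>n. \<integral>\<omega>. f (W n \<omega>) \<partial>M) \<longlonglongrightarrow> (\<integral>\<omega>. f (Z \<omega>) \<partial>N))"

(* Convergence to 0 in probability. A map obtained by plugging a random variable into
   \<theta> \<mapsto> E[h(X^\<theta>, \<theta>0) - h(X^\<theta>0, \<theta>0)] need not be measurable, and "measure" vanishes on
   non-measurable sets; hence the outer measure. For measurable R it is the usual notion,
   see small_op_measurable. *)
definition small_op :: "'b measure \<Rightarrow> (nat \<Rightarrow> 'b \<Rightarrow> real) \<Rightarrow> bool" where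
  "small_op M R \<longleftrightarrow>
     (\<forall>\<epsilon>>0. (\<lambda>n. outer_measure_of M {\<omega> \<in> space M. \<epsilon> < \<bar>R n \<omega>\<bar>}) \<longlonglongrightarrow> 0)"

lemma small_op_measurable:
  assumes "prob_space M" and R: "\<And>n. R n \<in> borel_measurable M"
  shows "small_op M R \<longleftrightarrow>
    (\<forall>\<epsilon>>0. (\<lambda>n. measure M {\<omega> \<in> space M. \<epsilon> < \<bar>R n \<omega>\<bar>}) \<longlonglongrightarrow> 0)"
proof -
  interpret prob_space M by fact
  have "{\<omega> \<in> space M. \<epsilon> < \<bar>R n \<omega>\<bar>} \<in> sets M" for \<epsilon> n
    using R[of n] by measurable
  then have "outer_measure_of M {\<omega> \<in> space M. \<epsilon> < \<bar>R n \<omega>\<bar>}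
      = ennreal (measure M {\<omega> \<in> space M. \<epsilon> < \<bar>R n \<omega>\<bar>})" for \<epsilon> n
    by (simp add: emeasure_eq_measure)
  then show ?thesis
    unfolding small_op_def by (simp add: ennreal_tendsto_0_iff)
qed

end

theory Submission
  imports Defs
begin

text \<open>The delta method. By (ii) at \<open>\<theta>0\<close> and (iii), the map \<open>u \<mapsto> E[h(X\<^bsup>\<theta>0 + u\<^esup>, \<theta>0) - h(X\<^bsup>\<theta>0\<^esup>, \<theta>0)]\<close>
  is differentiable at \<open>0\<close> within \<open>\<Theta> - \<theta>0\<close>, with derivative \<open>u \<mapsto> E[G] \<bullet> u\<close>. The rescaled
  estimation error converges in distribution, hence is tight, so plugging it into the first-order
  remainder gives a term that is small in probability.\<close>

text \<open>The indicator of a tail event is not a continuous test function, but a ramp in the norm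
  dominates it. Far enough out, the ramp has small integral under the limit law, and convergence in
  distribution carries this over to all large \<open>n\<close>.\<close>

lemma converges_in_distr_tight:
  fixes W :: "nat \<Rightarrow> 'b \<Rightarrow> 's::real_normed_vector"
  assumes M: "prob_space M" and N: "prob_space N"
    and conv: "converges_in_distr M W N Z" and "0 < e"
  obtains K where "0 < K"
    "\<forall>\<^sub>F n in sequentially. measure M {\<omega> \<in> space M. K < norm (W n \<omega>)} < e"
proof -
  interpret M: prob_space M by fact
  interpret N: prob_space N by fact
  \<comment> \<open>The ramp: 0 on the ball of radius \<open>i\<close>, 1 from radius
    \<open>i + 1\<close> on, linear in the norm between.\<close>
  define f :: "nat \<Rightarrow> 's \<Rightarrow> real" where "f i x = min 1 (max 0 (norm x - real i))" for i x
  have W [measurable]: "W n \<in> borel_measurable M" for n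
    using conv by (auto simp: converges_in_distr_def)
  have Z [measurable]: "Z \<in> borel_measurable N"
    using conv by (auto simp: converges_in_distr_def)
  have f_cont: "continuous_on UNIV (f i)" for i
    unfolding f_def by (intro continuous_intros)
  have f_abs: "\<bar>f i x\<bar> \<le> 1" for i x
    by (auto simp: f_def)
  have f_meas [measurable]: "f i \<in> borel_measurable borel" for i
    using f_cont by (rule borel_measurable_continuous_onI)
  have f_lim: "(\<lambda>i. f i x) \<longlonglongrightarrow> 0" for x
  proof (rule tendsto_eventually)
    obtain k :: nat where "norm x \<le> real k"
      using real_arch_simple by blast
    then show "\<forall>\<^sub>F i in sequentially. f i x = 0"
      by (intro eventually_sequentiallyI[of k]) (auto simp: f_def)
  qed
  \<comment> \<open>Only the limit law is involved here, so \<open>i\<close> is fixed before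
    \<open>n\<close> varies.\<close>
  have "(\<lambda>i. \<integral>\<omega>. f i (Z \<omega>) \<partial>N) \<longlonglongrightarrow> (\<integral>\<omega>. 0 \<partial>N)"
    by (rule integral_dominated_convergence[where w = "\<lambda>_. 1"]) (auto simp: f_abs f_lim)
  then have "\<forall>\<^sub>F i in sequentially. (\<integral>\<omega>. f i (Z \<omega>) \<partial>N) < e"
    using \<open>0 < e\<close> by (auto intro: order_tendstoD)
  then obtain i where i: "(\<integral>\<omega>. f i (Z \<omega>) \<partial>N) < e"
    by (auto simp: eventually_sequentially)
  have "bounded (range (f i))"
    using f_abs by (auto simp: bounded_iff)
  then have "(\<lambda>n. \<integral>\<omega>. f i (W n \<omega>) \<partial>M) \<longlonglongrightarrow> (\<integral>\<omega>. f i (Z \<omega>) \<partial>N)"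
    using conv f_cont by (auto simp: converges_in_distr_def)
  then have ev: "\<forall>\<^sub>F n in sequentially. (\<integral>\<omega>. f i (W n \<omega>) \<partial>M) < e"
    using i by (rule order_tendstoD)
  \<comment> \<open>The radius is \<open>i + 1\<close> because the ramp has reached 1 there; this
    also keeps \<open>K\<close> positive when \<open>i = 0\<close>.\<close>
  have le: "measure M {\<omega> \<in> space M. real i + 1 < norm (W n \<omega>)} \<le> (\<integral>\<omega>. f i (W n \<omega>) \<partial>M)" for n
  proof -
    let ?A = "{\<omega> \<in> space M. real i + 1 < norm (W n \<omega>)}"
    have A: "?A \<in> sets M"
      by measurable
    have "measure M ?A = (\<integral>\<omega>. indicator ?A \<omega> \<partial>M)"
      using A by simp
    also have "\<dots> \<le> (\<integral>\<omega>. f i (W n \<omega>) \<partial>M)"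
    proof (rule integral_mono)
      show "integrable M (indicator ?A :: _ \<Rightarrow> real)"
        using A by (simp add: M.emeasure_eq_measure)
      show "integrable M (\<lambda>\<omega>. f i (W n \<omega>))"
        by (rule M.integrable_const_bound[where B = 1]) (auto simp: f_abs)
    qed (auto simp: f_def indicator_def)
    finally show ?thesis .
  qed
  show thesis
  proof (rule that)
    show "\<forall>\<^sub>F n in sequentially. measure M {\<omega> \<in> space M. real i + 1 < norm (W n \<omega>)} < e"
      using ev by eventually_elim (rule le_less_trans[OF le])
  qed simp
qed

text \<open>Where \<open>W n\<close> is bounded by \<open>K\<close>, the factor \<open>a n\<close>
  eventually forces \<open>a n * norm (W n \<omega>)\<close> below any \<delta>, and
  \<open>R n\<close> is then at most \<eta> times \<open>K\<close>. A large \<open>R n\<close> thus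
  lies inside a tail event of \<open>W n\<close>, and monotonicity of the outer measure
  suffices.\<close>

lemma small_op_remainder:
  fixes W :: "nat \<Rightarrow> 'b \<Rightarrow> 's::real_normed_vector"
  assumes M: "prob_space M" and N: "prob_space N"
    and conv: "converges_in_distr M W N Z"
    and a: "a \<longlonglongrightarrow> (0::real)"
    and R: "\<And>\<eta>. 0 < \<eta> \<Longrightarrow> \<exists>\<delta>>0. \<forall>n. \<forall>\<omega>\<in>space M.
      a n * norm (W n \<omega>) < \<delta> \<longrightarrow> \<bar>R n \<omega>\<bar> \<le> \<eta> * norm (W n \<omega>)"
    and a_nonneg: "\<And>n. 0 \<le> a n"
  shows "small_op M R"
  unfolding small_op_def
proof (intro allI impI)
  fix \<epsilon> :: real
  assume "0 < \<epsilon>"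
  interpret prob_space M by fact
  have W [measurable]: "W n \<in> borel_measurable M" for n
    using conv by (auto simp: converges_in_distr_def)
  show "(\<lambda>n. outer_measure_of M {\<omega> \<in> space M. \<epsilon> < \<bar>R n \<omega>\<bar>}) \<longlonglongrightarrow> 0"
  proof (rule order_tendstoI)
    fix y :: ennreal
    assume "0 < y"
    \<comment> \<open>\<open>y\<close> may be infinite; an intermediate \<open>z\<close> is finite
      and so comes from a real \<open>e\<close>.\<close>
    then obtain z where z: "0 < z" "z < y"
      using dense by blast
    then obtain e where e: "0 < e" "ennreal e < y"
      by (cases z) auto
    obtain K where K: "0 < K"
      "\<forall>\<^sub>F n in sequentially. measure M {\<omega> \<in> space M. K < norm (W n \<omega>)} < e"
      using converges_in_distr_tight[OF M N conv \<open>0 < e\<close>] .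
    \<comment> \<open>The slope \<open>\<epsilon> / K\<close> is chosen so that the bound is at most
      \<epsilon> as long as \<open>norm (W n \<omega>) \<le> K\<close>.\<close>
    obtain \<delta> where \<delta>: "0 < \<delta>" and R_le: "\<And>n \<omega>. \<lbrakk>\<omega> \<in> space M; a n * norm (W n \<omega>) < \<delta>\<rbrakk>
        \<Longrightarrow> \<bar>R n \<omega>\<bar> \<le> \<epsilon> / K * norm (W n \<omega>)"
      using R[of "\<epsilon> / K"] \<open>0 < \<epsilon>\<close> \<open>0 < K\<close> by auto
    have "\<forall>\<^sub>F n in sequentially. a n < \<delta> / K"
      using a \<delta> \<open>0 < K\<close> by (intro order_tendstoD) auto
    with K(2) show "\<forall>\<^sub>F n in sequentially. outer_measure_of M {\<omega> \<in> space M. \<epsilon> < \<bar>R n \<omega>\<bar>} < y"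
    proof eventually_elim
      fix n
      assume tail: "measure M {\<omega> \<in> space M. K < norm (W n \<omega>)} < e" and an: "a n < \<delta> / K"
      have sub: "{\<omega> \<in> space M. \<epsilon> < \<bar>R n \<omega>\<bar>} \<subseteq> {\<omega> \<in> space M. K < norm (W n \<omega>)}"
      proof safe
        fix \<omega>
        assume \<omega>: "\<omega> \<in> space M" "\<epsilon> < \<bar>R n \<omega>\<bar>"
        show "K < norm (W n \<omega>)"
        proof (rule ccontr)
          assume *: "\<not> K < norm (W n \<omega>)"
          then have "a n * norm (W n \<omega>) \<le> a n * K"
            using a_nonneg[of n] by (intro mult_left_mono) auto
          also have "\<dots> < \<delta>"
            using an \<open>0 < K\<close> by (simp add: field_simps)
          finally have "\<bar>R n \<omega>\<bar> \<le> \<epsilon> / K * norm (W n \<omega>)"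
            using R_le \<omega> by blast
          also have "\<dots> \<le> \<epsilon> / K * K"
            using * \<open>0 < \<epsilon>\<close> \<open>0 < K\<close> by (intro mult_left_mono) auto
          finally show False
            using \<omega> \<open>0 < K\<close> by simp
        qed
      qed
      have "outer_measure_of M {\<omega> \<in> space M. \<epsilon> < \<bar>R n \<omega>\<bar>}
          \<le> outer_measure_of M {\<omega> \<in> space M. K < norm (W n \<omega>)}"
        using sub by (rule outer_measure_of_mono)
      \<comment> \<open>The tail event is measurable, so its outer measure is its
        probability.\<close>
      also have "\<dots> = ennreal (measure M {\<omega> \<in> space M. K < norm (W n \<omega>)})"
        by (simp add: emeasure_eq_measure)
      also have "\<dots> \<le> ennreal e"
        using tail by (intro ennreal_leI) auto
      finally show "outer_measure_of M {\<omega> \<in> space M. \<epsilon> < \<bar>R n \<omega>\<bar>} < y"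
        using e by (auto intro: le_less_trans)
    qed
  \<comment> \<open>The other half of \<open>order_tendstoI\<close> is vacuous: no extended
    nonnegative real is below 0.\<close>
  qed auto
qed

theorem theorem2p2:
  fixes M :: "'b measure"
    and NZ :: "'c measure" and NZs :: "'d measure"
    and Z :: "'c \<Rightarrow> real ^ 'p" and Zs :: "'d \<Rightarrow> real ^ 'p"
    and \<Theta> :: "(real ^ 'p) set" and \<theta>0 :: "real ^ 'p"
    and X :: "real ^ 'p \<Rightarrow> 'b \<Rightarrow> 'x::real_normed_vector"
    and h :: "'x \<Rightarrow> real ^ 'p \<Rightarrow> real"
    and \<theta>hat :: "nat \<Rightarrow> 'b \<Rightarrow> real ^ 'p"
    and \<gamma> :: "nat \<Rightarrow> real ^ 'p"
    and Y :: "real ^ 'p \<Rightarrow> 'b \<Rightarrow> 'x ^ 'p"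
    and G :: "'b \<Rightarrow> real ^ 'p"
    and q c :: real and r :: "real ^ 'p \<Rightarrow> real"
  assumes "prob_space M" and "prob_space NZ" and "prob_space NZs"
    and "\<theta>0 \<in> \<Theta>"
    and "\<And>\<theta>. \<theta> \<in> \<Theta> \<Longrightarrow> X \<theta> \<in> borel_measurable M"
    and "\<And>n. \<theta>hat n \<in> borel_measurable M"
    and "\<And>n \<omega>. \<omega> \<in> space M \<Longrightarrow> \<theta>hat n \<omega> \<in> \<Theta>"
    and "q > 1"
    \<comment> \<open>the expectations in (iii) and in the conclusion exist\<close>
    and "\<And>\<theta>. \<theta> \<in> \<Theta> \<Longrightarrow> integrable M (\<lambda>\<omega>. h (X \<theta> \<omega>) \<theta>0 - h (X \<theta>0 \<omega>) \<theta>0)"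
    \<comment> \<open>(i)\<close>
    and "\<And>n k. \<gamma> n $ k > 0"
    and "decseq (\<lambda>n. max_entry (\<gamma> n))" and "(\<lambda>n. max_entry (\<gamma> n)) \<longlonglongrightarrow> 0"
    and "converges_in_distr M
           (\<lambda>n \<omega>. matrix_inv (diag_matrix (\<gamma> n)) *v (\<theta>hat n \<omega> - \<theta>0)) NZ Z"
    and "converges_in_distr M
           (\<lambda>n \<omega>. inverse (max_entry (\<gamma> n)) *\<^sub>R (\<theta>hat n \<omega> - \<theta>0)) NZs Zs"
    \<comment> \<open>(ii)\<close>
    and "\<And>\<theta>. \<theta> \<in> \<Theta> \<Longrightarrow> in_Lq M q (Y \<theta>)"
    and "\<forall>\<epsilon>>0. \<exists>\<delta>>0. \<forall>\<theta>\<in>\<Theta>. \<forall>u. \<theta> + u \<in> \<Theta> \<longrightarrow> norm u < \<delta> \<longrightarrow>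
           Lq_norm M q (\<lambda>\<omega>. X (\<theta> + u) \<omega> - X \<theta> \<omega> - lincomb u (Y \<theta> \<omega>))
             \<le> ennreal (\<epsilon> * norm u)"
    \<comment> \<open>(iii)\<close>
    and "integrable M G"
    and "c > 0"
    and "r \<in> o[at 0 within {u. \<theta>0 + u \<in> \<Theta>}](\<lambda>u. norm u)"
    and "\<And>u. \<theta>0 + u \<in> \<Theta> \<Longrightarrow>
           ennreal \<bar>\<integral>\<omega>. (h (X (\<theta>0 + u) \<omega>) \<theta>0 - h (X \<theta>0 \<omega>) \<theta>0 - u \<bullet> G \<omega>) \<partial>M\<bar>
             \<le> ennreal c *
                 Lq_norm M q (\<lambda>\<omega>. X (\<theta>0 + u) \<omega> - X \<theta>0 \<omega> - lincomb u (Y \<theta>0 \<omega>))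
               + ennreal (r u)"
  shows "small_op M (\<lambda>n \<omega>.
           inverse (max_entry (\<gamma> n)) *
             (\<lambda>\<theta>. \<integral>\<omega>'. (h (X \<theta> \<omega>') \<theta>0 - h (X \<theta>0 \<omega>') \<theta>0) \<partial>M) (\<theta>hat n \<omega>)
           - (\<integral>\<omega>'. G \<omega>' \<partial>M) \<bullet> (inverse (max_entry (\<gamma> n)) *\<^sub>R (\<theta>hat n \<omega> - \<theta>0)))"
proof -
  note M = assms(1) and NZs = assms(3) and \<theta>hat_in = assms(7) and int_h = assms(9)
    and \<gamma>_pos = assms(10) and \<gamma>_lim = assms(12) and conv = assms(14) and diff_X = assms(16)
    and int_G = assms(17) and c = assms(18) and r_small = assms(19) and bound = assms(20)
  \<comment> \<open>The first-order remainder at \<theta>0; divided by \<open>a n\<close> and taken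
    at \<open>\<theta>hat n \<omega> - \<theta>0\<close>, it is the term in the conclusion.\<close>
  define g where "g u = (\<integral>\<omega>. (h (X (\<theta>0 + u) \<omega>) \<theta>0 - h (X \<theta>0 \<omega>) \<theta>0) \<partial>M) - u \<bullet> (\<integral>\<omega>. G \<omega> \<partial>M)" for u
  define a where "a n = max_entry (\<gamma> n)" for n
  define W where "W n \<omega> = inverse (a n) *\<^sub>R (\<theta>hat n \<omega> - \<theta>0)" for n \<omega>
  have a_pos: "0 < a n" for n
    using \<gamma>_pos[of n] by (auto simp: a_def max_entry_def Max_gr_iff)
  have g_eq: "(\<integral>\<omega>. (h (X (\<theta>0 + u) \<omega>) \<theta>0 - h (X \<theta>0 \<omega>) \<theta>0 - u \<bullet> G \<omega>) \<partial>M) = g u"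
    if "\<theta>0 + u \<in> \<Theta>" for u
    unfolding g_def using int_h[OF that] int_G by simp
  \<comment> \<open>The filter \<open>at 0 within\<close> leaves out the point 0, so the little-o
    bound on \<open>r\<close> cannot cover this case.\<close>
  have g_0: "g 0 = 0"
    by (simp add: g_def)
  have g_small: "\<exists>\<delta>>0. \<forall>u. \<theta>0 + u \<in> \<Theta> \<longrightarrow> norm u < \<delta> \<longrightarrow> \<bar>g u\<bar> \<le> \<eta> * norm u"
    if \<eta>: "0 < \<eta>" for \<eta>
  proof -
    \<comment> \<open>After multiplication by \<open>c\<close> this uses half of \<eta>; the other
      half is for \<open>r\<close>.\<close>
    have "0 < \<eta> / (2 * c)"
      using \<eta> c by simp
    then obtain d1 where d1: "0 < d1" and X_le: "\<And>u. \<lbrakk>\<theta>0 + u \<in> \<Theta>; norm u < d1\<rbrakk> \<Longrightarrow>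
        Lq_norm M q (\<lambda>\<omega>. X (\<theta>0 + u) \<omega> - X \<theta>0 \<omega> - lincomb u (Y \<theta>0 \<omega>))
          \<le> ennreal (\<eta> / (2 * c) * norm u)"
      using diff_X \<open>\<theta>0 \<in> \<Theta>\<close> by meson
    have "\<forall>\<^sub>F u in at 0 within {u. \<theta>0 + u \<in> \<Theta>}. norm (r u) \<le> \<eta> / 2 * norm (norm u)"
      using landau_o.smallD[OF r_small, of "\<eta> / 2"] \<eta> by simp
    then obtain d2 where d2: "0 < d2" and r_le: "\<And>u. \<lbrakk>\<theta>0 + u \<in> \<Theta>; u \<noteq> 0; norm u < d2\<rbrakk> \<Longrightarrow>
        \<bar>r u\<bar> \<le> \<eta> / 2 * norm u"
      by (auto simp: eventually_at)
    have "\<bar>g u\<bar> \<le> \<eta> * norm u" if u: "\<theta>0 + u \<in> \<Theta>" "norm u < min d1 d2" for u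
    proof (cases "u = 0")
      case True
      then show ?thesis by (simp add: g_0)
    next
      case False
      have "ennreal \<bar>g u\<bar> \<le> ennreal c *
          Lq_norm M q (\<lambda>\<omega>. X (\<theta>0 + u) \<omega> - X \<theta>0 \<omega> - lincomb u (Y \<theta>0 \<omega>)) + ennreal (r u)"
        using bound[OF u(1)] by (simp only: g_eq[OF u(1)])
      also have "\<dots> \<le> ennreal c * ennreal (\<eta> / (2 * c) * norm u) + ennreal (\<eta> / 2 * norm u)"
        using u r_le[of u] False
        by (intro add_mono mult_left_mono X_le ennreal_leI) auto
      also have "ennreal c * ennreal (\<eta> / (2 * c) * norm u) = ennreal (c * (\<eta> / (2 * c) * norm u))"
        using c \<eta> by (intro ennreal_mult[symmetric]) auto
      also have "\<dots> + ennreal (\<eta> / 2 * norm u) = ennreal (c * (\<eta> / (2 * c) * norm u) + \<eta> / 2 * norm u)"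
        using c \<eta> by (intro ennreal_plus[symmetric]) auto
      also have "c * (\<eta> / (2 * c) * norm u) + \<eta> / 2 * norm u = \<eta> * norm u"
        using c by (simp add: field_simps)
      finally show ?thesis
        using \<eta> by (simp add: ennreal_le_iff)
    qed
    with d1 d2 show ?thesis
      by (intro exI[of _ "min d1 d2"]) auto
  qed
  \<comment> \<open>Undoing the scaling turns the smallness condition of
    \<open>small_op_remainder\<close> into closeness of the estimator to \<theta>0.\<close>
  have norm_W: "a n * norm (W n \<omega>) = norm (\<theta>hat n \<omega> - \<theta>0)" for n \<omega>
    using a_pos[of n] by (simp add: W_def)
  have "small_op M (\<lambda>n \<omega>. inverse (a n) * g (\<theta>hat n \<omega> - \<theta>0))"
  proof (rule small_op_remainder[OF M NZs])
    show "converges_in_distr M W NZs Zs"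
      using conv by (simp add: W_def[abs_def] a_def)
    show "a \<longlonglongrightarrow> 0"
      using \<gamma>_lim by (simp add: a_def[abs_def])
    show "0 \<le> a n" for n
      using a_pos[of n] by simp
  next
    fix \<eta> :: real
    assume "0 < \<eta>"
    then obtain \<delta> where "0 < \<delta>" and
      g_le: "\<And>u. \<lbrakk>\<theta>0 + u \<in> \<Theta>; norm u < \<delta>\<rbrakk> \<Longrightarrow> \<bar>g u\<bar> \<le> \<eta> * norm u"
      using g_small by blast
    \<comment> \<open>The bound on \<open>g\<close> is linear in the norm, so dividing by
      \<open>a n\<close> turns the error into \<open>W n \<omega>\<close> with the same \<eta>, and
      \<delta> depends on neither \<open>n\<close> nor \<omega>.\<close>
    have "\<bar>inverse (a n) * g (\<theta>hat n \<omega> - \<theta>0)\<bar> \<le> \<eta> * norm (W n \<omega>)"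
      if "\<omega> \<in> space M" "a n * norm (W n \<omega>) < \<delta>" for n \<omega>
    proof -
      have "\<bar>g (\<theta>hat n \<omega> - \<theta>0)\<bar> \<le> \<eta> * (a n * norm (W n \<omega>))"
        using g_le[of "\<theta>hat n \<omega> - \<theta>0"] that \<theta>hat_in[of \<omega> n] by (simp add: norm_W)
      then show ?thesis
        using a_pos[of n] by (simp add: abs_mult field_simps)
    qed
    with \<open>0 < \<delta>\<close> show "\<exists>\<delta>>0. \<forall>n. \<forall>\<omega>\<in>space M. a n * norm (W n \<omega>) < \<delta> \<longrightarrow>
        \<bar>inverse (a n) * g (\<theta>hat n \<omega> - \<theta>0)\<bar> \<le> \<eta> * norm (W n \<omega>)"
      by blast
  qed
  then show ?thesis
    by (simp add: g_def a_def right_diff_distrib inner_commute)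
qed

end
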